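(* Consider nested Hamiltonian hierarchies of gyrostat low-order models in which the number of gyrostats $K$ is incremented by one at each step with a consistent mode-coupling pattern. The incremental condition for the enlarged system to remain non-canonical Hamiltonian (that is, the condition $\mathcal{J}_{K+1}-\mathcal{J}_{K}=0$ for all $x$, where $\mathcal{J}_K$ denotes the Jacobi expression of the $K$-gyrostat system) depends only on the parameters of the newly added gyrostat and those of immediately preceding gyrostats that share modes with it.
   Context: A gyrostat low-order model (GLOM) with $K$ gyrostats and $M$ modes is given, for each $k\in\{1,\dots,K\}$, by an ordered triple of distinct mode indices $(m_1^{(k)},m_2^{(k)},m_3^{(k)})$ in $\{1,\dots,M\}$ and real parameters $a_k,b_k,c_k,p_k,q_k,r_k$ with $p_k+q_k+r_k=0$. Gyrostat $k$ contributes $p_k y_2y_3+b_k y_3-c_k y_2$, $q_k y_3y_1+c_k y_1-a_k y_3$, $r_k y_1y_2+a_k y_2-b_k y_1$ to $\dot x_{m_1^{(k)}},\dot x_{m_2^{(k)}},\dot x_{m_3^{(k)}}$ respectively, where $y_l=x_{m_l^{(k)}}$, and $\dot x_i$ is the sum of all contributions to it. Its skew-symmetric matrix is $\mathrm{J}=\sum_{k=1}^K\mathrm{J}^{(k)}$, where $\mathrm{J}^{(k)}$ is the $M\times M$ matrix that is zero except for the block $$\begin{bmatrix}0&-c_k&p_ky_2+b_k\\ c_k&0&q_ky_1-a_k\\ -(p_ky_2+b_k)&-(q_ky_1-a_k)&0\end{bmatrix}$$ in the rows and columns $m_1^{(k)},m_2^{(k)},m_3^{(k)}$. It satisfies $\dot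 x_i=\sum_j\mathrm{J}_{ij}x_j$. The Jacobi expression of the $K$-gyrostat system is $$\mathcal{J}_K=\epsilon_{ijk}\sum_{l=1}^K\mathrm{J}^{(l)}_{im}\sum_{l'=1}^K\frac{\partial\mathrm{J}^{(l')}_{jk}}{\partial x_m}$$ (repeated indices $i,j,k,m$ summed over all modes, matrices being padded by zeros when modes are added; $\epsilon_{ijk}$ is the alternating symbol, equal to $0$ if two indices coincide and otherwise to the sign of the permutation sorting $(i,j,k)$ into increasing order). The system is non-canonical Hamiltonian if $\mathcal{J}_K=0$ for all $x$. Nested hierarchies are families of GLOMs in which each increment of $K$ by one adds one or two new modes. They comprise the sparse nested hierarchy, with $M=2K+1$ and gyrostat $k$ having mode triple $(2k-1,2k,2k+1)$, and the dense nested hierarchy, with $M=K+2$ and gyrostat $k$ having mode triple $(k,k+1,k+2)$. A consistent mode-coupling pattern means that each newly added gyrostat is coupled to its predecessors in the same way at every step. *)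

theory Defs
  imports "HOL-Analysis.Analysis" "HOL-Combinatorics.Permutations"
begin

record gyrostat =
  par_a :: real
  par_b :: real
  par_c :: real
  par_p :: real
  par_q :: real
  par_r :: real

text \<open>
  Gyrostats and modes are numbered from 1. A map \<open>m\<close> gives the mode triple of gyrostat \<open>k\<close> as
  \<open>(m k 1, m k 2, m k 3)\<close>; its values at other positions are irrelevant. A state is a function
  \<open>x\<close> on all of \<open>nat\<close>, of which an \<open>M\<close>-mode model only reads \<open>x 1, \<dots>, x M\<close>.
\<close>

definition gyrostat_parameters :: "(nat \<Rightarrow> gyrostat) \<Rightarrow> bool" where
  "gyrostat_parameters P \<longleftrightarrow> (\<forall>k\<ge>1. par_p (P k) + par_q (P k) + par_r (P k) = 0)"

definition modes :: "(nat \<Rightarrow> nat \<Rightarrow> nat) \<Rightarrow> nat \<Rightarrow> nat set" where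
  "modes m k = m k ` {1, 2, 3}"

definition gyrostat_field ::
    "(nat \<Rightarrow> nat) \<Rightarrow> gyrostat \<Rightarrow> (nat \<Rightarrow> real) \<Rightarrow> nat \<Rightarrow> real" where
  "gyrostat_field t g x i =
    (if i = t 1 then par_p g * x (t 2) * x (t 3) + par_b g * x (t 3) - par_c g * x (t 2)
     else if i = t 2 then par_q g * x (t 3) * x (t 1) + par_c g * x (t 1) - par_a g * x (t 3)
     else if i = t 3 then par_r g * x (t 1) * x (t 2) + par_a g * x (t 2) - par_b g * x (t 1)
     else 0)"

text \<open>
  The matrix of one gyrostat with mode triple \<open>(t 1, t 2, t 3)\<close>. The parameter \<open>r\<close> enters only
  through \<open>r = - (p + q)\<close>; see the lemma below.
\<close>

definition gyrostat_J ::
    "(nat \<Rightarrow> nat) \<Rightarrow> gyrostat \<Rightarrow> (nat \<Rightarrow> real) \<Rightarrow> nat \<Rightarrow> nat \<Rightarrow> real" where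
  "gyrostat_J t g x i j =
    (if i = t 1 \<and> j = t 2 then - par_c g
     else if i = t 1 \<and> j = t 3 then par_p g * x (t 2) + par_b g
     else if i = t 2 \<and> j = t 1 then par_c g
     else if i = t 2 \<and> j = t 3 then par_q g * x (t 1) - par_a g
     else if i = t 3 \<and> j = t 1 then - (par_p g * x (t 2) + par_b g)
     else if i = t 3 \<and> j = t 2 then - (par_q g * x (t 1) - par_a g)
     else 0)"

lemma gyrostat_J_field:
  assumes inj: "inj_on t {1, 2, 3}" and sub: "t ` {1, 2, 3} \<subseteq> {1..N}"
    and pqr: "par_p g + par_q g + par_r g = 0"
  shows "(\<Sum>j = 1..N. gyrostat_J t g x i j * x j) = gyrostat_field t g x i"
proof -
  have ne: "t 1 \<noteq> t 2" "t 1 \<noteq> t 3" "t 2 \<noteq> t 3" "t 2 \<noteq> t 1" "t 3 \<noteq> t 1" "t 3 \<noteq> t 2"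
    using inj by (auto simp: inj_on_def)
  have r: "par_r g = - par_p g - par_q g" using pqr by linarith
  have "(\<Sum>j = 1..N. gyrostat_J t g x i j * x j) = (\<Sum>j \<in> {t 1, t 2, t 3}. gyrostat_J t g x i j * x j)"
    by (rule sum.mono_neutral_right) (use sub in \<open>auto simp: gyrostat_J_def\<close>)
  also have "\<dots> = gyrostat_J t g x i (t 1) * x (t 1) + gyrostat_J t g x i (t 2) * x (t 2)
      + gyrostat_J t g x i (t 3) * x (t 3)"
    using ne by simp
  also have "\<dots> = gyrostat_field t g x i"
    using ne by (auto simp: gyrostat_J_def gyrostat_field_def r algebra_simps)
  finally show ?thesis .
qed

definition partial_deriv :: "((nat \<Rightarrow> real) \<Rightarrow> real) \<Rightarrow> nat \<Rightarrow> (nat \<Rightarrow> real) \<Rightarrow> real" where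
  "partial_deriv f n x = deriv (\<lambda>t. f (x(n := t))) (x n)"

definition alternating :: "nat \<Rightarrow> nat \<Rightarrow> nat \<Rightarrow> real" where
  "alternating i j k =
    (if distinct [i, j, k]
     then of_int (sign (THE \<pi>. \<pi> permutes {..<3} \<and> sorted (map (\<lambda>u. [i, j, k] ! \<pi> u) [0..<3])))
     else 0)"

definition jacobi_expr ::
    "(nat \<Rightarrow> nat \<Rightarrow> nat) \<Rightarrow> (nat \<Rightarrow> nat) \<Rightarrow> (nat \<Rightarrow> gyrostat) \<Rightarrow> nat \<Rightarrow> (nat \<Rightarrow> real) \<Rightarrow> real" where
  "jacobi_expr m M P K x =
    (\<Sum>i = 1..M K. \<Sum>j = 1..M K. \<Sum>k = 1..M K. \<Sum>n = 1..M K.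
      alternating i j k
      * (\<Sum>l = 1..K. gyrostat_J (m l) (P l) x i n)
      * (\<Sum>l' = 1..K. partial_deriv (\<lambda>y. gyrostat_J (m l') (P l') y j k) n x))"

definition noncanonical_hamiltonian ::
    "(nat \<Rightarrow> nat \<Rightarrow> nat) \<Rightarrow> (nat \<Rightarrow> nat) \<Rightarrow> (nat \<Rightarrow> gyrostat) \<Rightarrow> nat \<Rightarrow> bool" where
  "noncanonical_hamiltonian m M P K \<longleftrightarrow> (\<forall>x. jacobi_expr m M P K x = 0)"

definition incremental_condition ::
    "(nat \<Rightarrow> nat \<Rightarrow> nat) \<Rightarrow> (nat \<Rightarrow> nat) \<Rightarrow> (nat \<Rightarrow> gyrostat) \<Rightarrow> nat \<Rightarrow> bool" where
  "incremental_condition m M P K \<longleftrightarrow>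
    (\<forall>x. jacobi_expr m M P (K + 1) x - jacobi_expr m M P K x = 0)"

text \<open>
  \<open>M K\<close> is the number of modes of the model with \<open>K\<close> gyrostats. The hierarchy starts from a
  single gyrostat; the modes added at a step are all taken from the triple of the new gyrostat.
\<close>

definition nested_hierarchy :: "(nat \<Rightarrow> nat \<Rightarrow> nat) \<Rightarrow> (nat \<Rightarrow> nat) \<Rightarrow> bool" where
  "nested_hierarchy m M \<longleftrightarrow>
    (\<forall>k\<ge>1. inj_on (m k) {1, 2, 3}) \<and>
    modes m 1 = {1..M 1} \<and>
    (\<forall>K\<ge>1. {1..M K} \<union> modes m (K + 1) = {1..M (K + 1)} \<and>
            (M (K + 1) = M K + 1 \<or> M (K + 1) = M K + 2))"

text \<open>
  The coupling of two gyrostats records which positions in their triples hold the same mode.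
  The pattern is consistent if every step adds the same number of modes and the coupling of a
  gyrostat to a predecessor depends only on how many steps earlier that predecessor was added.
\<close>

definition coupling :: "(nat \<Rightarrow> nat \<Rightarrow> nat) \<Rightarrow> nat \<Rightarrow> nat \<Rightarrow> (nat \<times> nat) set" where
  "coupling m k l = {(u, v). u \<in> {1, 2, 3} \<and> v \<in> {1, 2, 3} \<and> m k u = m l v}"

definition consistent_coupling :: "(nat \<Rightarrow> nat \<Rightarrow> nat) \<Rightarrow> (nat \<Rightarrow> nat) \<Rightarrow> bool" where
  "consistent_coupling m M \<longleftrightarrow>
    (\<exists>s. \<forall>K\<ge>1. M (K + 1) = M K + s) \<and>
    (\<forall>k l. 1 \<le> l \<and> l < k \<longrightarrow> coupling m (k + 1) (l + 1) = coupling m k l)"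

definition sharing_predecessors :: "(nat \<Rightarrow> nat \<Rightarrow> nat) \<Rightarrow> nat \<Rightarrow> nat set" where
  "sharing_predecessors m k = {l. 1 \<le> l \<and> l < k \<and> modes m l \<inter> modes m k \<noteq> {}}"

definition sparse_modes :: "nat \<Rightarrow> nat \<Rightarrow> nat" where
  "sparse_modes k u = 2 * k + u - 2"

definition dense_modes :: "nat \<Rightarrow> nat \<Rightarrow> nat" where
  "dense_modes k u = k + u - 1"

lemma sparse_modes_triple:
  assumes "k \<ge> 1"
  shows "sparse_modes k 1 = 2 * k - 1" "sparse_modes k 2 = 2 * k" "sparse_modes k 3 = 2 * k + 1"
  using assms by (auto simp: sparse_modes_def)

lemma dense_modes_triple:
  assumes "k \<ge> 1"
  shows "dense_modes k 1 = k" "dense_modes k 2 = k + 1" "dense_modes k 3 = k + 2"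
  using assms by (auto simp: dense_modes_def)

lemma sparse_hierarchy:
  "nested_hierarchy sparse_modes (\<lambda>K. 2 * K + 1)"
  "consistent_coupling sparse_modes (\<lambda>K. 2 * K + 1)"
proof -
  have "{1..2 * K + 1} \<union> modes sparse_modes (K + 1) = {1..2 * (K + 1) + 1}" for K
    by (auto simp: modes_def sparse_modes_def)
  moreover have "modes sparse_modes 1 = {1..2 * 1 + 1}"
    by (auto simp: modes_def sparse_modes_def)
  moreover have "inj_on (sparse_modes k) {1, 2, 3}" if "k \<ge> 1" for k
    using that by (auto simp: inj_on_def sparse_modes_def)
  ultimately show "nested_hierarchy sparse_modes (\<lambda>K. 2 * K + 1)"
    unfolding nested_hierarchy_def by auto
  have "coupling sparse_modes (k + 1) (l + 1) = coupling sparse_modes k l" if "1 \<le> l" "l < k" for k l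
    using that by (auto simp: coupling_def sparse_modes_def)
  then show "consistent_coupling sparse_modes (\<lambda>K. 2 * K + 1)"
    unfolding consistent_coupling_def by (intro conjI exI[of _ 2]) auto
qed

lemma dense_hierarchy:
  "nested_hierarchy dense_modes (\<lambda>K. K + 2)"
  "consistent_coupling dense_modes (\<lambda>K. K + 2)"
proof -
  have "{1..K + 2} \<union> modes dense_modes (K + 1) = {1..(K + 1) + 2}" for K
    by (auto simp: modes_def dense_modes_def)
  moreover have "modes dense_modes 1 = {1..1 + 2}"
    by (auto simp: modes_def dense_modes_def)
  moreover have "inj_on (dense_modes k) {1, 2, 3}" if "k \<ge> 1" for k
    using that by (auto simp: inj_on_def dense_modes_def)
  ultimately show "nested_hierarchy dense_modes (\<lambda>K. K + 2)"
    unfolding nested_hierarchy_def by auto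
  have "coupling dense_modes (k + 1) (l + 1) = coupling dense_modes k l" if "1 \<le> l" "l < k" for k l
    using that by (auto simp: coupling_def dense_modes_def)
  then show "consistent_coupling dense_modes (\<lambda>K. K + 2)"
    unfolding consistent_coupling_def by (intro conjI exI[of _ 1]) auto
qed

end

theory Submission imports Defs begin

text \<open>
  A product \<open>J\<^sup>l\<^sub>i\<^sub>n \<cdot> \<partial>\<^sub>n J\<^sup>l\<^sup>'\<^sub>j\<^sub>k\<close> can only be nonzero if \<open>n\<close> is a mode of both gyrostats, so of the terms
  that gyrostat \<open>K + 1\<close> adds to the Jacobi expression only those pairing it with itself or with a
  predecessor sharing a mode survive. That these predecessors are consecutive is a counting argument:
  by consistency, gyrostats \<open>k\<close> and \<open>k + 1\<close> have as many modes in common as gyrostats \<open>1\<close> and \<open>2\<close>,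
  which is the number of old modes of gyrostat \<open>k + 1\<close>. So every old mode of a gyrostat is already a
  mode of its immediate predecessor, and the gyrostats containing a given mode form an interval.
\<close>

lemma gyrostat_J_eq_0:
  assumes "i \<notin> t ` {1, 2, 3} \<or> j \<notin> t ` {1, 2, 3}"
  shows "gyrostat_J t g x i j = 0"
  using assms by (elim disjE) (simp_all add: gyrostat_J_def)

text \<open>The differentiated function is constant in the varied coordinate: an entry reads the
  state only at \<open>t 1\<close> and \<open>t 2\<close>, and entries outside the block are
  identically zero. Hence no differentiability has to be shown.\<close>

lemma partial_deriv_gyrostat_J_eq_0:
  assumes "i \<notin> t ` {1, 2, 3} \<or> j \<notin> t ` {1, 2, 3} \<or> n \<notin> t ` {1, 2, 3}"
  shows "partial_deriv (\<lambda>y. gyrostat_J t g y i j) n x = 0"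
proof -
  have "gyrostat_J t g (x(n := s)) i j = gyrostat_J t g x i j" for s
  proof (cases "n \<in> t ` {1, 2, 3}")
    case True
    then show ?thesis using assms by (simp add: gyrostat_J_eq_0)
  next
    case False
    then have "(x(n := s)) (t 1) = x (t 1)" "(x(n := s)) (t 2) = x (t 2)" by auto
    then show ?thesis by (simp only: gyrostat_J_def)
  qed
  then show ?thesis
    unfolding partial_deriv_def by simp
qed

text \<open>Serves to pad the smaller system with zeros, so that both Jacobi expressions range over
  the same modes.\<close>

lemma sum4_mono_neutral:
  fixes f :: "'a \<Rightarrow> 'a \<Rightarrow> 'a \<Rightarrow> 'a \<Rightarrow> 'b::comm_monoid_add"
  assumes "finite B" "A \<subseteq> B"
    and zero: "\<And>i j k n. \<not> (i \<in> A \<and> j \<in> A \<and> k \<in> A \<and> n \<in> A) \<Longrightarrow> f i j k n = 0"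
  shows "(\<Sum>i\<in>A. \<Sum>j\<in>A. \<Sum>k\<in>A. \<Sum>n\<in>A. f i j k n) = (\<Sum>i\<in>B. \<Sum>j\<in>B. \<Sum>k\<in>B. \<Sum>n\<in>B. f i j k n)"
  by (intro sum.mono_neutral_cong_left assms ballI sum.neutral) (auto intro: zero)

lemma nested_hierarchy_modes_subset:
  assumes "nested_hierarchy m M" "1 \<le> l" "l \<le> k"
  shows "modes m l \<subseteq> {1..M k}"
  using assms(3)
proof (induction k rule: dec_induct)
  case base
  show ?case
  proof (cases "l = 1")
    case True
    then show ?thesis using assms unfolding nested_hierarchy_def by auto
  next
    case False
    then have "l = (l - 1) + 1" "1 \<le> l - 1" using \<open>1 \<le> l\<close> by auto
    then show ?thesis using assms(1) unfolding nested_hierarchy_def by (metis Un_upper2)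
  qed
next
  case (step k)
  have "{1..M k} \<subseteq> {1..M (k + 1)}"
    using assms step.hyps unfolding nested_hierarchy_def by (metis Un_upper1 le_trans)
  then show ?case using step.IH by (metis Suc_eq_plus1 order_trans)
qed

text \<open>The Jacobi expression is a sum over pairs of gyrostats, so the difference keeps the
  pairs that contain gyrostat \<open>K + 1\<close>. The second inner sum stops at \<open>K\<close>
  so that the pair of \<open>K + 1\<close> with itself is counted once.\<close>

lemma jacobi_expr_diff:
  assumes "nested_hierarchy m M" "K \<ge> 1"
  shows "jacobi_expr m M P (K + 1) x - jacobi_expr m M P K x =
    (\<Sum>i = 1..M (K + 1). \<Sum>j = 1..M (K + 1). \<Sum>k = 1..M (K + 1). \<Sum>n = 1..M (K + 1).
      alternating i j k *
      ((\<Sum>l = 1..K + 1. gyrostat_J (m (K + 1)) (P (K + 1)) x i n *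
          partial_deriv (\<lambda>y. gyrostat_J (m l) (P l) y j k) n x) +
       (\<Sum>l = 1..K. gyrostat_J (m l) (P l) x i n *
          partial_deriv (\<lambda>y. gyrostat_J (m (K + 1)) (P (K + 1)) y j k) n x)))"
proof -
  let ?A = "\<lambda>l i n. gyrostat_J (m l) (P l) x i n"
  let ?D = "\<lambda>l j k n. partial_deriv (\<lambda>y. gyrostat_J (m l) (P l) y j k) n x"
  have sub: "m l ` {1, 2, 3} \<subseteq> {1..M K}" if "l \<in> {1..K}" for l
    using nested_hierarchy_modes_subset[OF assms(1), of l K] that by (simp add: modes_def)
  have "{1..M K} \<subseteq> {1..M (K + 1)}"
    using assms unfolding nested_hierarchy_def by (metis Un_upper1)
  then have pad: "jacobi_expr m M P K x =
    (\<Sum>i = 1..M (K + 1). \<Sum>j = 1..M (K + 1). \<Sum>k = 1..M (K + 1). \<Sum>n = 1..M (K + 1).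
      alternating i j k * (\<Sum>l = 1..K. ?A l i n) * (\<Sum>l = 1..K. ?D l j k n))"
    unfolding jacobi_expr_def
  proof (intro sum4_mono_neutral)
    fix i j k n
    assume out: "\<not> (i \<in> {1..M K} \<and> j \<in> {1..M K} \<and> k \<in> {1..M K} \<and> n \<in> {1..M K})"
    show "alternating i j k * (\<Sum>l = 1..K. ?A l i n) * (\<Sum>l = 1..K. ?D l j k n) = 0"
    \<comment> \<open>If \<open>i\<close> and \<open>n\<close> are both old modes, then
      \<open>j\<close> or \<open>k\<close> is new and the derivatives vanish; otherwise the matrix
      entries do.\<close>
    proof (cases "i \<in> {1..M K} \<and> n \<in> {1..M K}")
      case True
      have "?D l j k n = 0" if "l \<in> {1..K}" for l
        using sub[OF that] True out by (intro partial_deriv_gyrostat_J_eq_0) blast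
      then show ?thesis by (simp add: sum.neutral)
    next
      case False
      have "?A l i n = 0" if "l \<in> {1..K}" for l
        using sub[OF that] False by (intro gyrostat_J_eq_0) blast
      then show ?thesis by (simp add: sum.neutral)
    qed
  qed auto
  have split: "e * (\<Sum>l = 1..K + 1. f l) * (\<Sum>l = 1..K + 1. g l) -
      e * (\<Sum>l = 1..K. f l) * (\<Sum>l = 1..K. g l) =
      e * ((\<Sum>l = 1..K + 1. f (K + 1) * g l) + (\<Sum>l = 1..K. f l * g (K + 1)))"
    for e :: real and f g
    unfolding sum_distrib_left[symmetric] sum_distrib_right[symmetric] by (simp add: algebra_simps)
  show ?thesis
    unfolding pad jacobi_expr_def[of m M P "K + 1"] sum_subtractf[symmetric]
    by (simp only: split[of _ "\<lambda>l. ?A l _ _" "\<lambda>l. ?D l _ _ _"])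
qed

lemma jacobi_expr_diff_cong:
  assumes "nested_hierarchy m M" "K \<ge> 1" "P (K + 1) = P' (K + 1)"
    and same: "\<forall>l \<in> sharing_predecessors m (K + 1). P l = P' l"
  shows "jacobi_expr m M P (K + 1) x - jacobi_expr m M P K x =
    jacobi_expr m M P' (K + 1) x - jacobi_expr m M P' K x"
proof -
  \<comment> \<open>Where the parameters may differ, the two triples are disjoint, so each
    \<open>n\<close> misses one of them and one factor of the product is zero for both parameter
    choices.\<close>
  have shared: "P l = P' l \<or> n \<notin> m l ` {1, 2, 3} \<or> n \<notin> m (K + 1) ` {1, 2, 3}"
    if "l \<in> {1..K + 1}" for l n
    using that same assms(3) unfolding sharing_predecessors_def modes_def
    by (cases "l = K + 1") auto
  have new_old: "gyrostat_J (m (K + 1)) (P' (K + 1)) x i n *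
        partial_deriv (\<lambda>y. gyrostat_J (m l) (P l) y j k) n x =
      gyrostat_J (m (K + 1)) (P' (K + 1)) x i n *
        partial_deriv (\<lambda>y. gyrostat_J (m l) (P' l) y j k) n x"
    if "l \<in> {1..K + 1}" for i j k l n
    using shared[OF that, of n]
    by (elim disjE) (simp_all add: gyrostat_J_eq_0 partial_deriv_gyrostat_J_eq_0)
  have old_new: "gyrostat_J (m l) (P l) x i n *
        partial_deriv (\<lambda>y. gyrostat_J (m (K + 1)) (P' (K + 1)) y j k) n x =
      gyrostat_J (m l) (P' l) x i n *
        partial_deriv (\<lambda>y. gyrostat_J (m (K + 1)) (P' (K + 1)) y j k) n x"
    if "l \<in> {1..K}" for i j k l n
  proof -
    have "l \<in> {1..K + 1}" using that by simp
    from shared[OF this, of n] show ?thesis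
      by (elim disjE) (simp_all add: gyrostat_J_eq_0 partial_deriv_gyrostat_J_eq_0)
  qed
  show ?thesis
    unfolding jacobi_expr_diff[OF assms(1,2)] assms(3)
    by (intro sum.cong refl arg_cong2[where f = "(*)"] arg_cong2[where f = "(+)"] new_old old_new)
qed

text \<open>Consistency speaks of couplings only; this turns it into a statement about the number of
  common modes.\<close>

lemma card_modes_Int:
  assumes "inj_on (m k) {1, 2, 3}"
  shows "card (modes m k \<inter> modes m l) = card (fst ` coupling m k l)"
proof -
  have "modes m k \<inter> modes m l = m k ` fst ` coupling m k l"
    unfolding modes_def coupling_def by force
  moreover have "inj_on (m k) (fst ` coupling m k l)"
    by (rule inj_on_subset[OF assms]) (auto simp: coupling_def)
  ultimately show ?thesis by (simp add: card_image)
qed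

lemma old_modes:
  assumes nest: "nested_hierarchy m M" and cons: "consistent_coupling m M" and "k \<ge> 1"
  shows "modes m (k + 1) \<inter> {1..M k} = modes m (k + 1) \<inter> modes m k"
    and "modes m (k + 1) \<inter> modes m k \<noteq> {}"
proof -
  obtain s where s: "M (j + 1) = M j + s" if "j \<ge> 1" for j
    using cons unfolding consistent_coupling_def by blast
  have s12: "s = 1 \<or> s = 2"
    using nest s[of 1] unfolding nested_hierarchy_def by fastforce
  have inj: "inj_on (m j) {1, 2, 3}" if "j \<ge> 1" for j
    using nest that unfolding nested_hierarchy_def by blast
  \<comment> \<open>All \<open>s\<close> modes added at a step belong to the triple of the new
    gyrostat, which leaves \<open>3 - s\<close> old ones.\<close>
  have card_old: "card (modes m (j + 1) \<inter> {1..M j}) = 3 - s" if "j \<ge> 1" for j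
  proof -
    have un: "{1..M j} \<union> modes m (j + 1) = {1..M j + s}"
      using nest that s[OF that] unfolding nested_hierarchy_def by metis
    then have sub: "modes m (j + 1) \<subseteq> {1..M j + s}"
      by blast
    have "modes m (j + 1) \<inter> {1..M j} = modes m (j + 1) - {M j + 1..M j + s}"
      using sub by force
    moreover have "{M j + 1..M j + s} \<subseteq> modes m (j + 1)"
    proof
      fix y assume y: "y \<in> {M j + 1..M j + s}"
      then have "y \<in> {1..M j} \<union> modes m (j + 1)" unfolding un by simp
      then show "y \<in> modes m (j + 1)" using y by simp
    qed
    moreover have "card (modes m (j + 1)) = 3"
      using inj[of "j + 1"] by (simp add: modes_def card_image)
    ultimately show ?thesis by (simp add: card_Diff_subset)
  qed
  have "coupling m (k + 1) k = coupling m 2 1"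
    using \<open>k \<ge> 1\<close>
  proof (induction k rule: dec_induct)
    case base
    show ?case by (simp add: numeral_2_eq_2)
  next
    case (step j)
    have "coupling m (j + 1 + 1) (j + 1) = coupling m (j + 1) j"
      using cons step.hyps unfolding consistent_coupling_def by simp
    then show ?case using step.IH by simp
  qed
  then have "card (modes m (k + 1) \<inter> modes m k) = card (modes m 2 \<inter> modes m 1)"
    using inj \<open>k \<ge> 1\<close> by (simp add: card_modes_Int)
  \<comment> \<open>The first gyrostat carries all modes of the one-gyrostat model, so for gyrostat
    2 the common modes are exactly the old ones.\<close>
  also have "\<dots> = 3 - s"
    using nest card_old[of 1] unfolding nested_hierarchy_def by (simp add: numeral_2_eq_2)
  finally have common: "card (modes m (k + 1) \<inter> modes m k) = 3 - s" .
  then show "modes m (k + 1) \<inter> modes m k \<noteq> {}"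
    using s12 by auto
  have "modes m (k + 1) \<inter> modes m k \<subseteq> modes m (k + 1) \<inter> {1..M k}"
    using nested_hierarchy_modes_subset[OF nest \<open>k \<ge> 1\<close>, of k] by auto
  then show "modes m (k + 1) \<inter> {1..M k} = modes m (k + 1) \<inter> modes m k"
    using common card_old[OF \<open>k \<ge> 1\<close>] by (metis card_subset_eq finite_Int finite_atLeastAtMost)
qed

text \<open>Descending from \<open>k\<close>: a mode of gyrostat \<open>l\<close> is already old
  when gyrostat \<open>i + 1\<close> with \<open>l \<le> i\<close> is added, so if
  \<open>i + 1\<close> carries it, \<open>old_modes\<close> passes it on to
  \<open>i\<close>.\<close>

lemma mode_interval:
  assumes "nested_hierarchy m M" "consistent_coupling m M"
    and "1 \<le> l" "l \<le> j" "j \<le> k" "x \<in> modes m l" "x \<in> modes m k"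
  shows "x \<in> modes m j"
  using assms(5)
proof (induction j rule: inc_induct)
  case base
  show ?case by (fact assms(7))
next
  case (step i)
  have "x \<in> {1..M i}"
    using nested_hierarchy_modes_subset[OF assms(1,3), of i] assms(4,6) step.hyps by auto
  then have "x \<in> modes m (i + 1) \<inter> {1..M i}"
    using step.IH by simp
  moreover have "1 \<le> i" using assms(3,4) step.hyps by simp
  ultimately show ?case
    using old_modes(1)[OF assms(1,2), of i] by blast
qed

lemma sharing_predecessors_interval:
  assumes "nested_hierarchy m M" "consistent_coupling m M" "K \<ge> 1"
  shows "\<exists>n \<in> {1..K}. sharing_predecessors m (K + 1) = {n..K}"
proof -
  let ?S = "sharing_predecessors m (K + 1)"
  have S: "?S \<subseteq> {1..K}" "K \<in> ?S"
    using old_modes(2)[OF assms] assms(3) by (auto simp: sharing_predecessors_def Int_commute)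
  then have fin: "finite ?S" by (auto intro: finite_subset)
  then have Min: "Min ?S \<in> ?S" using S(2) by (intro Min_in) auto
  \<comment> \<open>One mode common to the earliest sharing predecessor and gyrostat
    \<open>K + 1\<close> is carried by every gyrostat in between.\<close>
  have "j \<in> ?S" if "j \<in> {Min ?S..K}" for j
  proof -
    obtain x where "x \<in> modes m (Min ?S)" "x \<in> modes m (K + 1)" "1 \<le> Min ?S"
      using Min unfolding sharing_predecessors_def by blast
    then have "x \<in> modes m j"
      using mode_interval[OF assms(1,2), of "Min ?S" j "K + 1" x] that by auto
    then show ?thesis
      using that \<open>x \<in> modes m (K + 1)\<close> \<open>1 \<le> Min ?S\<close> unfolding sharing_predecessors_def by auto
  qed
  then have "?S = {Min ?S..K}" using S(1) fin by auto
  then show ?thesis using Min S(1) by blast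
qed

lemma sharing_predecessors_sparse:
  assumes "K \<ge> 1"
  shows "sharing_predecessors sparse_modes (K + 1) = {K}"
  using assms by (auto simp: sharing_predecessors_def modes_def sparse_modes_def)

text \<open>A dense triple overlaps the two preceding ones; \<open>max 1\<close> covers
  \<open>K = 1\<close>, where only one predecessor exists.\<close>

lemma sharing_predecessors_dense:
  assumes "K \<ge> 1"
  shows "sharing_predecessors dense_modes (K + 1) = {max 1 (K - 1)..K}"
  using assms by (auto simp: sharing_predecessors_def modes_def dense_modes_def)

text \<open>Dependence on certain parameters only is expressed as invariance under changes of all
  the others.\<close>

theorem proposition4:
  fixes m :: "nat \<Rightarrow> nat \<Rightarrow> nat" and M :: "nat \<Rightarrow> nat" and K :: nat
  assumes "nested_hierarchy m M" and "consistent_coupling m M" and "K \<ge> 1"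
  shows "(\<forall>P. gyrostat_parameters P \<and> noncanonical_hamiltonian m M P K \<longrightarrow>
             (noncanonical_hamiltonian m M P (K + 1) \<longleftrightarrow> incremental_condition m M P K)) \<and>
         (\<forall>P P'. gyrostat_parameters P \<and> gyrostat_parameters P' \<and>
             P (K + 1) = P' (K + 1) \<and>
             (\<forall>l \<in> sharing_predecessors m (K + 1). P l = P' l) \<longrightarrow>
             (incremental_condition m M P K \<longleftrightarrow> incremental_condition m M P' K)) \<and>
         (\<exists>n \<in> {1..K}. sharing_predecessors m (K + 1) = {n..K}) \<and>
         sharing_predecessors sparse_modes (K + 1) = {K} \<and>
         sharing_predecessors dense_modes (K + 1) = {max 1 (K - 1)..K}"
proof (intro conjI allI impI)
  fix P assume "gyrostat_parameters P \<and> noncanonical_hamiltonian m M P K"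
  then show "noncanonical_hamiltonian m M P (K + 1) \<longleftrightarrow> incremental_condition m M P K"
    by (simp add: noncanonical_hamiltonian_def incremental_condition_def)
next
  fix P P' assume "gyrostat_parameters P \<and> gyrostat_parameters P' \<and> P (K + 1) = P' (K + 1) \<and>
    (\<forall>l \<in> sharing_predecessors m (K + 1). P l = P' l)"
  then have "jacobi_expr m M P (K + 1) x - jacobi_expr m M P K x =
      jacobi_expr m M P' (K + 1) x - jacobi_expr m M P' K x" for x
    using jacobi_expr_diff_cong[OF assms(1,3), of P P' x] by blast
  then show "incremental_condition m M P K \<longleftrightarrow> incremental_condition m M P' K"
    unfolding incremental_condition_def by simp
qed (fact sharing_predecessors_interval[OF assms] sharing_predecessors_sparse[OF assms(3)]
    sharing_predecessors_dense[OF assms(3)])+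

end
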